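(* For every positive integer $n$, the number of $n\times n$ nilpotent matrices over the Boolean semiring $\mathbb{B}$ is equal to the number of directed acyclic graphs on $n$ ordered (i.e. labeled) vertices.
   Context: The Boolean semiring is $\mathbb{B}=\{0,1\}$ with the usual $0,1$ operations except that $1+1=1$. Matrices over $\mathbb{B}$ are multiplied using the operations of $\mathbb{B}$, and a square matrix $A$ over $\mathbb{B}$ is nilpotent if $A^N=0$ for some $N>0$. A directed acyclic graph is a directed graph (at most one directed edge from any vertex $j$ to any vertex $i$) with no directed cycles (in particular, no loops). *)

theory Defs
  imports "Jordan_Normal_Form.Matrix" "Graph_Theory.Pair_Digraph"
begin

text \<open>The Boolean semiring. This is not the two-element field of HOL-Library.Z2:
  here \<open>1 + 1 = 1\<close>.\<close>

datatype boolsr = Zero_B | One_B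

instantiation boolsr :: comm_semiring_1
begin

definition zero_boolsr :: boolsr where "0 = Zero_B"

definition one_boolsr :: boolsr where "1 = One_B"

fun plus_boolsr :: "boolsr \<Rightarrow> boolsr \<Rightarrow> boolsr" where
  "Zero_B + Zero_B = Zero_B"
| "Zero_B + One_B = One_B"
| "One_B + Zero_B = One_B"
| "One_B + One_B = One_B"

fun times_boolsr :: "boolsr \<Rightarrow> boolsr \<Rightarrow> boolsr" where
  "Zero_B * Zero_B = Zero_B"
| "Zero_B * One_B = Zero_B"
| "One_B * Zero_B = Zero_B"
| "One_B * One_B = One_B"

instance
proof
  fix a b c :: boolsr
  show "a * b * c = a * (b * c)" by (cases a; cases b; cases c) simp_all
  show "a * b = b * a" by (cases a; cases b) simp_all
  show "1 * a = a" by (cases a) (simp_all add: one_boolsr_def)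
  show "a + b + c = a + (b + c)" by (cases a; cases b; cases c) simp_all
  show "a + b = b + a" by (cases a; cases b) simp_all
  show "0 + a = a" by (cases a) (simp_all add: zero_boolsr_def)
  show "(a + b) * c = a * c + b * c" by (cases a; cases b; cases c) simp_all
  show "0 * a = 0" by (cases a) (simp_all add: zero_boolsr_def)
  show "a * 0 = 0" by (cases a) (simp_all add: zero_boolsr_def)
  show "(0 :: boolsr) \<noteq> 1" by (simp add: zero_boolsr_def one_boolsr_def)
qed

end

definition nilpotent_mat :: "'a :: semiring_1 mat \<Rightarrow> bool" where
  "nilpotent_mat A \<longleftrightarrow>
     square_mat A \<and> (\<exists>N>0. A ^\<^sub>m N = 0\<^sub>m (dim_row A) (dim_row A))"

text \<open>Arcs are ordered pairs of vertices, so there is at most one arc from any vertex to any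
  other. The library's notion of cycle counts a loop as a cycle of length one.\<close>

definition directed_acyclic_graph :: "'a pair_pre_digraph \<Rightarrow> bool" where
  "directed_acyclic_graph G \<longleftrightarrow>
     pair_wf_digraph G \<and> \<not> (\<exists>p. pre_digraph.cycle (with_proj G) p)"

end

theory Submission
  imports Defs
begin

text \<open>
  A Boolean matrix carries no more information than the positions of its nonzero entries, so
  \<open>n \<times> n\<close> Boolean matrices are the same thing as sets of arcs on the vertices \<open>{0..<n}\<close>, with an
  arc from \<open>i\<close> to \<open>j\<close> wherever the entry at \<open>(i, j)\<close> is nonzero. Under this correspondence
  nilpotent matrices are exactly the acyclic digraphs, and the theorem is the resulting bijection.

  The reason is that nothing cancels in the Boolean semiring: a sum of products is nonzero as soon
  as one of its terms is, so the entry of \<open>A\<^sup>N\<close> at \<open>(i, j)\<close> is nonzero exactly when there is a walk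
  of length \<open>N\<close> from \<open>i\<close> to \<open>j\<close> (\<open>mat_rel_pow\<close>). Hence \<open>A\<close> is nilpotent iff some positive
  length is not the length of any walk. A cycle can be traversed arbitrarily often and so gives walks
  of arbitrarily large length, whose initial segments are walks of every smaller length; conversely,
  without cycles the number of vertices reachable from the current position drops at every step,
  which bounds the length of all walks (\<open>relpow_eq_empty_iff_acyclic\<close>).
\<close>

text \<open>The number of vertices reachable by at least one step is a potential that bounds the length
  of walks.\<close>

lemma acyclic_relpow_card_bound:
  assumes "finite R" "acyclic R" "(x, y) \<in> R ^^ N"
  shows "card (R\<^sup>+ `` {y}) + N \<le> card (R\<^sup>+ `` {x})"
  using assms(3)
proof (induction N arbitrary: y)
  case 0
  then show ?case by simp
next
  case (Suc N)
  then obtain z where xz: "(x, z) \<in> R ^^ N" and zy: "(z, y) \<in> R"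
    by (auto elim: relpow_Suc_E)
  have "y \<in> R\<^sup>+ `` {z}" "y \<notin> R\<^sup>+ `` {y}"
    using zy \<open>acyclic R\<close> by (auto simp: acyclic_def)
  moreover have "R\<^sup>+ `` {y} \<subseteq> R\<^sup>+ `` {z}"
    using zy by (auto intro: trancl_into_trancl2)
  ultimately have "R\<^sup>+ `` {y} \<subset> R\<^sup>+ `` {z}"
    by blast
  moreover have "finite (R\<^sup>+ `` {z})"
    using \<open>finite R\<close> by simp
  ultimately have "card (R\<^sup>+ `` {y}) < card (R\<^sup>+ `` {z})"
    by (intro psubset_card_mono)
  with Suc.IH[OF xz] show ?case by simp
qed

lemma relpow_eq_empty_iff_acyclic:
  assumes "finite R"
  shows "(\<exists>N>0. R ^^ N = {}) \<longleftrightarrow> acyclic R"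
proof
  assume "\<exists>N>0. R ^^ N = {}"
  then obtain N where N: "N > 0" "R ^^ N = {}" by blast
  show "acyclic R"
    unfolding acyclic_def
  proof (intro allI notI)
    fix x assume "(x, x) \<in> R\<^sup>+"
    then obtain k where k: "k > 0" "(x, x) \<in> R ^^ k"
      by (auto simp: trancl_power)
    \<comment> \<open>Going around the cycle \<open>N\<close> times gives a walk of length at least \<open>N\<close>, and its first \<open>N\<close>
      steps are a walk of length exactly \<open>N\<close>.\<close>
    have walk: "(x, x) \<in> R ^^ (m * k)" for m
    proof (induction m)
      case (Suc m)
      with k have "(x, x) \<in> R ^^ k O R ^^ (m * k)" by blast
      then show ?case by (simp only: mult_Suc relpow_add)
    qed simp
    have "N * k = N + N * (k - 1)"
      using k by (cases k) auto
    then have "R ^^ (N * k) = R ^^ N O R ^^ (N * (k - 1))"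
      by (simp only: relpow_add)
    with N walk[of N] show False
      by simp
  qed
next
  assume "acyclic R"
  have "(x, y) \<notin> R ^^ Suc (card (Range R))" for x y
  proof
    assume "(x, y) \<in> R ^^ Suc (card (Range R))"
    from acyclic_relpow_card_bound[OF assms \<open>acyclic R\<close> this]
    have "card (Range R) < card (R\<^sup>+ `` {x})" by simp
    moreover have "R\<^sup>+ `` {x} \<subseteq> Range R"
      using trancl_range[of R] by blast
    ultimately show False
      using card_mono[of "Range R" "R\<^sup>+ `` {x}"] \<open>finite R\<close> by (simp add: finite_Range)
  qed
  then have "R ^^ Suc (card (Range R)) = {}"
    by (intro equals0I) (metis surj_pair)
  then show "\<exists>N>0. R ^^ N = {}"
    by (intro exI conjI) (rule zero_less_Suc)
qed

text \<open>A closed walk of positive length contains a cycle, so forbidding simple cycles already makes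
  the transitive closure of the arc relation irreflexive.\<close>

lemma directed_acyclic_graph_iff:
  "directed_acyclic_graph G \<longleftrightarrow>
     parcs G \<subseteq> pverts G \<times> pverts G \<and> acyclic (parcs G)"
proof -
  have "pair_wf_digraph G \<longleftrightarrow> parcs G \<subseteq> pverts G \<times> pverts G"
    by (force simp: pair_wf_digraph_def)
  moreover have "(\<exists>p. pre_digraph.cycle (with_proj G) p) \<longleftrightarrow> \<not> acyclic (parcs G)"
    if "pair_wf_digraph G"
  proof -
    interpret pair_wf_digraph G by fact
    have "(\<exists>p. cycle p) \<longleftrightarrow> (\<exists>u p. awalk u p u \<and> p \<noteq> [])"
      using closed_w_imp_cycle by (auto simp: cycle_def closed_w_def)
    then show ?thesis
      by (auto simp: acyclic_def reachable1_awalk)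
  qed
  ultimately show ?thesis
    by (auto simp: directed_acyclic_graph_def)
qed

lemma boolsr_plus_eq_0_iff: "a + b = 0 \<longleftrightarrow> a = 0 \<and> b = 0" for a b :: boolsr
  by (cases a; cases b) (simp_all add: zero_boolsr_def)

lemma boolsr_times_eq_0_iff: "a * b = 0 \<longleftrightarrow> a = 0 \<or> b = 0" for a b :: boolsr
  by (cases a; cases b) (simp_all add: zero_boolsr_def)

lemma boolsr_eq_iff: "a = b \<longleftrightarrow> (a = 0 \<longleftrightarrow> b = 0)" for a b :: boolsr
  by (cases a; cases b) (simp_all add: zero_boolsr_def)

lemma boolsr_sum_eq_0_iff:
  fixes f :: "'a \<Rightarrow> boolsr"
  assumes "finite S"
  shows "sum f S = 0 \<longleftrightarrow> (\<forall>x\<in>S. f x = 0)"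
  using assms by induction (auto simp: boolsr_plus_eq_0_iff)

definition mat_rel :: "'a :: zero mat \<Rightarrow> nat rel" where
  "mat_rel A = {(i, j). i < dim_row A \<and> j < dim_col A \<and> A $$ (i, j) \<noteq> 0}"

lemma mat_rel_subset: "A \<in> carrier_mat n m \<Longrightarrow> mat_rel A \<subseteq> {0..<n} \<times> {0..<m}"
  by (auto simp: mat_rel_def)

text \<open>Matrix multiplication turns into relational composition because no sum of nonzero terms
  vanishes.\<close>

lemma mat_rel_mult:
  fixes A B :: "boolsr mat"
  assumes "dim_col A = dim_row B"
  shows "mat_rel (A * B) = mat_rel A O mat_rel B"
proof -
  have "(A * B) $$ (i, j) = 0 \<longleftrightarrow> (\<forall>k<dim_row B. A $$ (i, k) = 0 \<or> B $$ (k, j) = 0)"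
    if "i < dim_row A" "j < dim_col B" for i j
    using that assms
    by (auto simp: scalar_prod_def boolsr_sum_eq_0_iff boolsr_times_eq_0_iff)
  then show ?thesis
    using assms by (auto simp: mat_rel_def relcomp_unfold simp del: index_mult_mat(1))
qed

lemma mat_rel_eq_empty_iff:
  "A \<in> carrier_mat n m \<Longrightarrow> mat_rel A = {} \<longleftrightarrow> A = 0\<^sub>m n m"
  by (auto simp: mat_rel_def)

text \<open>The exponent is positive because \<open>A\<^sup>0\<close> is the identity matrix, whose relation is the identity
  on the vertices \<open>{0..<n}\<close> only, whereas the zeroth power of a relation is the identity on all
  natural numbers.\<close>

lemma mat_rel_pow:
  fixes A :: "boolsr mat"
  assumes "A \<in> carrier_mat n n" "N > 0"
  shows "mat_rel (A ^\<^sub>m N) = mat_rel A ^^ N"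
  using assms(2)
proof (induction N rule: nat_induct_non_zero)
  case 1
  then show ?case using assms(1) by simp
next
  case (Suc N)
  then show ?case using assms(1) by (simp add: mat_rel_mult)
qed

lemma nilpotent_mat_iff_acyclic:
  fixes A :: "boolsr mat"
  assumes "A \<in> carrier_mat n n"
  shows "nilpotent_mat A \<longleftrightarrow> acyclic (mat_rel A)"
proof -
  have "A ^\<^sub>m N = 0\<^sub>m n n \<longleftrightarrow> mat_rel A ^^ N = {}" if "N > 0" for N
    using mat_rel_eq_empty_iff[of "A ^\<^sub>m N" n n] mat_rel_pow[OF assms that] assms by simp
  then have "nilpotent_mat A \<longleftrightarrow> (\<exists>N>0. mat_rel A ^^ N = {})"
    using assms by (auto simp: nilpotent_mat_def)
  moreover have "finite (mat_rel A)"
    using mat_rel_subset[OF assms] by (rule finite_subset) simp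
  ultimately show ?thesis
    by (simp add: relpow_eq_empty_iff_acyclic)
qed

lemma bij_betw_mat_rel:
  "bij_betw mat_rel (carrier_mat n m :: boolsr mat set) (Pow ({0..<n} \<times> {0..<m}))"
proof (rule bij_betwI)
  let ?mat = "\<lambda>R. mat n m (\<lambda>ij. if ij \<in> R then 1 else 0 :: boolsr)"
  show "mat_rel \<in> (carrier_mat n m :: boolsr mat set) \<rightarrow> Pow ({0..<n} \<times> {0..<m})"
    using mat_rel_subset by blast
  show "?mat \<in> Pow ({0..<n} \<times> {0..<m}) \<rightarrow> carrier_mat n m"
    by simp
  show "?mat (mat_rel A) = A" if "A \<in> carrier_mat n m" for A
  proof (rule eq_matI)
    fix i j assume "i < dim_row A" "j < dim_col A"
    then show "?mat (mat_rel A) $$ (i, j) = A $$ (i, j)"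
      using that by (subst boolsr_eq_iff) (auto simp: mat_rel_def)
  qed (use that in auto)
  show "mat_rel (?mat R) = R" if "R \<in> Pow ({0..<n} \<times> {0..<m})" for R
    using that by (auto simp: mat_rel_def split: if_splits)
qed

theorem proposition2p2:
  fixes n :: nat
  assumes "n > 0"
  shows "card {A :: boolsr mat. A \<in> carrier_mat n n \<and> nilpotent_mat A} =
         card {G :: nat pair_pre_digraph. pverts G = {0..<n} \<and> directed_acyclic_graph G}"
proof -
  let ?M = "{A :: boolsr mat. A \<in> carrier_mat n n \<and> nilpotent_mat A}"
  let ?R = "{R. R \<subseteq> {0..<n} \<times> {0..<n} \<and> acyclic R}"
  let ?G = "{G :: nat pair_pre_digraph. pverts G = {0..<n} \<and> directed_acyclic_graph G}"
  have "bij_betw mat_rel ?M ?R"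
  proof (rule bij_betw_subset[OF bij_betw_mat_rel])
    have "?R = {R \<in> mat_rel ` (carrier_mat n n :: boolsr mat set). acyclic R}"
      using bij_betw_imp_surj_on[OF bij_betw_mat_rel] by auto
    then show "mat_rel ` ?M = ?R"
      by (auto simp: nilpotent_mat_iff_acyclic)
  qed auto
  moreover have "bij_betw parcs ?G ?R"
    by (rule bij_betwI[where g = "\<lambda>R. \<lparr>pverts = {0..<n}, parcs = R\<rparr>"])
      (auto simp: directed_acyclic_graph_iff)
  ultimately show ?thesis
    by (simp add: bij_betw_same_card)
qed

end
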